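(* Let $\mathbb{H}$ be a (real or complex) Hilbert space with scalar field $\mathbb{K}$, let $A$ be a positive bounded linear operator on $\mathbb{H}$, let $\epsilon\in[0,1)$ and let $x,y\in\mathbb{H}$. Then $x\bot_A^{\epsilon}y$ if and only if $x\bot_{\epsilon(A)}y$; that is, $|\langle x,y\rangle_A|\le \epsilon\|x\|_A\|y\|_A$ if and only if $\|x+\lambda y\|_A^2\ge \|x\|_A^2-2\epsilon\|x\|_A\|\lambda y\|_A$ for all $\lambda\in\mathbb{K}$.
   Context: A bounded linear operator $A$ on $\mathbb{H}$ is positive if $A=A^*$ and $\langle Ax,x\rangle\ge 0$ for all $x\in\mathbb{H}$. It induces the semi-inner product $\langle x,y\rangle_A=\langle Ax,y\rangle$ (linear in the first argument) and the seminorm $\|x\|_A=\sqrt{\langle Ax,x\rangle}$. The element $x$ is $(\epsilon,A)$-approximate orthogonal to $y$, written $x\bot_A^{\epsilon}y$, if $|\langle x,y\rangle_A|\le\epsilon\|x\|_A\|y\|_A$. The element $x$ is $(\epsilon,A)$-approximate orthogonal to $y$ in the sense of Chmieliński, written $x\bot_{\epsilon(A)}y$, if $\|x+\lambda y\|_A^2\ge\|x\|_A^2-2\epsilon\|x\|_A\|\lambda y\|_A$ for all $\lambda\in\mathbb{K}$. *)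

theory Defs
  imports "HOL-Analysis.Analysis"
begin

text \<open>
  Real Hilbert spaces are the types of sort \<open>{real_inner, complete_space}\<close>. The libraries have no
  complex inner product spaces, so they are introduced here on top of the underlying real inner
  product space, whose inner product is the real part of the complex one. Positive definiteness,
  \<open>norm x = sqrt (Re (cinner x x))\<close>, the metric and the topology are thereby inherited from
  class \<open>real_inner\<close>; the unit law for \<open>scaleC\<close> follows from \<open>scaleR_scaleC\<close>.
  The inner product is linear in its first argument.
  Complex Hilbert spaces are the types of sort \<open>{complex_inner, complete_space}\<close>.
\<close>

class complex_inner = real_inner +
  fixes scaleC :: "complex \<Rightarrow> 'a \<Rightarrow> 'a"  (infixr "*\<^sub>C" 75)
    and cinner :: "'a \<Rightarrow> 'a \<Rightarrow> complex"
  assumes scaleC_add_right: "c *\<^sub>C (x + y) = c *\<^sub>C x + c *\<^sub>C y"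
    and scaleC_add_left: "(c + d) *\<^sub>C x = c *\<^sub>C x + d *\<^sub>C x"
    and scaleC_scaleC: "c *\<^sub>C d *\<^sub>C x = (c * d) *\<^sub>C x"
    and scaleR_scaleC: "r *\<^sub>R x = complex_of_real r *\<^sub>C x"
    and cinner_commute: "cinner x y = cnj (cinner y x)"
    and cinner_add_left: "cinner (x + y) z = cinner x z + cinner y z"
    and cinner_scaleC_left: "cinner (c *\<^sub>C x) y = c * cinner x y"
    and inner_eq_Re_cinner: "inner x y = Re (cinner x y)"

lemma scaleC_one: "1 *\<^sub>C x = (x :: 'a::complex_inner)"
  using scaleR_scaleC[of 1 x] by simp

lemma norm_eq_sqrt_cinner: "norm x = sqrt (Re (cinner x x))" for x :: "'a::complex_inner"
  by (simp add: norm_eq_sqrt_inner inner_eq_Re_cinner)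

lemma cinner_self: "cinner x x = complex_of_real ((norm x)\<^sup>2)" for x :: "'a::complex_inner"
proof -
  have "Im (cinner x x) = 0"
    using arg_cong[OF cinner_commute[of x x], of Im] by simp
  then show ?thesis
    by (simp add: complex_eq_iff power2_norm_eq_inner inner_eq_Re_cinner)
qed

instantiation complex :: complex_inner
begin

definition "scaleC c (z :: complex) = c * z"
definition "cinner (z :: complex) w = z * cnj w"

instance
  by standard
    (auto simp: scaleC_complex_def cinner_complex_def inner_complex_def scaleR_conv_of_real
      algebra_simps)

end


subsection \<open>Real scalars\<close>

text \<open>
  In both definitions of positivity, \<open>A = A\<^sup>*\<close> is expressed by saying that \<open>A\<close> satisfies the
  identity which defines its adjoint.
\<close>

definition positive_op :: "('a::real_inner \<Rightarrow> 'a) \<Rightarrow> bool" where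
  "positive_op A \<longleftrightarrow> bounded_linear A \<and> (\<forall>x y. inner (A x) y = inner x (A y))
     \<and> (\<forall>x. inner (A x) x \<ge> 0)"

definition inner_op :: "('a::real_inner \<Rightarrow> 'a) \<Rightarrow> 'a \<Rightarrow> 'a \<Rightarrow> real" where
  "inner_op A x y = inner (A x) y"

definition seminorm_op :: "('a::real_inner \<Rightarrow> 'a) \<Rightarrow> 'a \<Rightarrow> real" where
  "seminorm_op A x = sqrt (inner (A x) x)"

definition approx_orth :: "real \<Rightarrow> ('a::real_inner \<Rightarrow> 'a) \<Rightarrow> 'a \<Rightarrow> 'a \<Rightarrow> bool" where
  "approx_orth \<epsilon> A x y \<longleftrightarrow> \<bar>inner_op A x y\<bar> \<le> \<epsilon> * seminorm_op A x * seminorm_op A y"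

definition chmielinski_orth :: "real \<Rightarrow> ('a::real_inner \<Rightarrow> 'a) \<Rightarrow> 'a \<Rightarrow> 'a \<Rightarrow> bool" where
  "chmielinski_orth \<epsilon> A x y \<longleftrightarrow> (\<forall>\<mu>::real.
     (seminorm_op A (x + \<mu> *\<^sub>R y))\<^sup>2
       \<ge> (seminorm_op A x)\<^sup>2 - 2 * \<epsilon> * seminorm_op A x * seminorm_op A (\<mu> *\<^sub>R y))"


subsection \<open>Complex scalars\<close>

definition cpositive_op :: "('a::complex_inner \<Rightarrow> 'a) \<Rightarrow> bool" where
  "cpositive_op A \<longleftrightarrow> bounded_linear A \<and> (\<forall>c x. A (c *\<^sub>C x) = c *\<^sub>C A x)
     \<and> (\<forall>x y. cinner (A x) y = cinner x (A y))
     \<and> (\<forall>x. cinner (A x) x \<in> \<real>\<^sub>\<ge>\<^sub>0)"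

definition cinner_op :: "('a::complex_inner \<Rightarrow> 'a) \<Rightarrow> 'a \<Rightarrow> 'a \<Rightarrow> complex" where
  "cinner_op A x y = cinner (A x) y"

definition cseminorm_op :: "('a::complex_inner \<Rightarrow> 'a) \<Rightarrow> 'a \<Rightarrow> real" where
  "cseminorm_op A x = sqrt (Re (cinner (A x) x))"

definition capprox_orth :: "real \<Rightarrow> ('a::complex_inner \<Rightarrow> 'a) \<Rightarrow> 'a \<Rightarrow> 'a \<Rightarrow> bool" where
  "capprox_orth \<epsilon> A x y \<longleftrightarrow> cmod (cinner_op A x y) \<le> \<epsilon> * cseminorm_op A x * cseminorm_op A y"

definition cchmielinski_orth :: "real \<Rightarrow> ('a::complex_inner \<Rightarrow> 'a) \<Rightarrow> 'a \<Rightarrow> 'a \<Rightarrow> bool" where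
  "cchmielinski_orth \<epsilon> A x y \<longleftrightarrow> (\<forall>\<mu>::complex.
     (cseminorm_op A (x + \<mu> *\<^sub>C y))\<^sup>2
       \<ge> (cseminorm_op A x)\<^sup>2 - 2 * \<epsilon> * cseminorm_op A x * cseminorm_op A (\<mu> *\<^sub>C y))"

end

theory Submission imports Defs begin

text \<open>
  Expanding the square, \<open>\<parallel>x + \<mu>y\<parallel>\<^sub>A\<^sup>2 = \<parallel>x\<parallel>\<^sub>A\<^sup>2 + 2 Re (cnj \<mu> \<langle>x,y\<rangle>\<^sub>A) + \<bar>\<mu>\<bar>\<^sup>2 \<parallel>y\<parallel>\<^sub>A\<^sup>2\<close>, and the middle term
  is twice the real inner product of the scalars \<open>\<mu>\<close> and \<open>\<langle>x,y\<rangle>\<^sub>A\<close>. For both scalar fields the claim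
  thus becomes one statement about the scalar \<open>s = \<langle>x,y\<rangle>\<^sub>A\<close>: Cauchy-Schwarz gives one direction, and
  \<open>\<mu> = -t s\<close> with \<open>t\<close> decreasing to \<open>0\<close> gives the other.
\<close>

text \<open>The scalar field itself is treated as a real inner product space \<open>'k\<close>, so
  one lemma serves both real and complex scalars. In the applications \<open>d\<close> is the
  squared seminorm of \<open>y\<close>, and \<open>k\<close> is \<epsilon> times the seminorms of
  \<open>x\<close> and \<open>y\<close>.\<close>

lemma norm_le_iff_inner_quadratic_nonneg:
  fixes s :: "'k::real_inner"
  assumes "0 \<le> d" and "0 \<le> k"
  shows "norm s \<le> k \<longleftrightarrow> (\<forall>\<mu>. 0 \<le> 2 * inner \<mu> s + (norm \<mu>)\<^sup>2 * d + 2 * k * norm \<mu>)"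
    (is "_ \<longleftrightarrow> (\<forall>\<mu>. ?P \<mu>)")
proof
  assume le: "norm s \<le> k"
  show "\<forall>\<mu>. ?P \<mu>"
  proof
    fix \<mu> :: 'k
    have "- inner \<mu> s \<le> norm \<mu> * norm s"
      using Cauchy_Schwarz_ineq2[of \<mu> s] by linarith
    also have "\<dots> \<le> norm \<mu> * k"
      using le by (simp add: mult_left_mono)
    finally have "0 \<le> 2 * inner \<mu> s + 2 * k * norm \<mu>"
      by (simp add: algebra_simps)
    moreover have "0 \<le> (norm \<mu>)\<^sup>2 * d"
      using assms by simp
    ultimately show "?P \<mu>" by linarith
  qed
next
  assume P: "\<forall>\<mu>. ?P \<mu>"
  show "norm s \<le> k"
  proof (cases "s = 0")
    case False
    define n where "n = norm s"
    have n: "0 < n" using False by (simp add: n_def)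
    have bound: "2 * (n - k) \<le> t * (n * d)" if t: "0 < t" for t :: real
    proof -
      have "0 \<le> 2 * (- t * n\<^sup>2) + (t * n)\<^sup>2 * d + 2 * k * (t * n)"
        using P[rule_format, of "(- t) *\<^sub>R s"] t
        by (simp add: n_def power2_norm_eq_inner)
      \<comment> \<open>The common factor \<open>t * n\<close> is positive and can be cancelled. The
        quadratic term keeps one further factor \<open>t\<close>.\<close>
      also have "\<dots> = (t * n) * (t * (n * d) - 2 * (n - k))"
        by (simp add: power2_eq_square algebra_simps)
      finally show ?thesis
        using mult_pos_pos[OF t n] by (simp add: zero_le_mult_iff)
    qed
    \<comment> \<open>As \<open>t\<close> decreases to 0 the right-hand side of \<open>bound\<close>
      vanishes, which leaves \<open>n - k \<le> 0\<close>.\<close>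
    have "((\<lambda>t. t * (n * d)) \<longlongrightarrow> 0 * (n * d)) (at_right 0)"
      by (intro tendsto_intros)
    moreover have "\<forall>\<^sub>F t in at_right 0. 2 * (n - k) \<le> t * (n * d)"
      using bound by (auto simp: eventually_at_right_field intro!: exI[of _ 1])
    ultimately have "2 * (n - k) \<le> 0 * (n * d)"
      by (intro tendsto_lowerbound) auto
    then show ?thesis by (simp add: n_def)
  qed (use assms in simp)
qed

lemma positive_op_inner_nonneg: "positive_op A \<Longrightarrow> 0 \<le> inner (A x) x"
  unfolding positive_op_def by blast

lemma seminorm_op_nonneg: "positive_op A \<Longrightarrow> 0 \<le> seminorm_op A x"
  unfolding seminorm_op_def by (intro real_sqrt_ge_zero positive_op_inner_nonneg)

lemma seminorm_op_scaleR:
  assumes "positive_op A"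
  shows "seminorm_op A (\<mu> *\<^sub>R x) = \<bar>\<mu>\<bar> * seminorm_op A x"
proof -
  interpret bounded_linear A using assms by (simp add: positive_op_def)
  show ?thesis
    by (simp add: seminorm_op_def scaleR real_sqrt_mult flip: mult.assoc)
qed

lemma seminorm_op_add_scaleR_sq:
  assumes "positive_op A"
  shows "(seminorm_op A (x + \<mu> *\<^sub>R y))\<^sup>2 =
    (seminorm_op A x)\<^sup>2 + 2 * inner \<mu> (inner_op A x y) + (norm \<mu>)\<^sup>2 * (seminorm_op A y)\<^sup>2"
proof -
  interpret bounded_linear A using assms by (simp add: positive_op_def)
  have sq: "(seminorm_op A z)\<^sup>2 = inner (A z) z" for z
    unfolding seminorm_op_def by (intro real_sqrt_pow2 positive_op_inner_nonneg assms)
  have "inner (A y) x = inner (A x) y"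
    using assms by (metis positive_op_def inner_commute)
  then show ?thesis
    unfolding sq
    by (simp add: add scaleR inner_op_def inner_add_left inner_add_right power2_eq_square
        algebra_simps)
qed

theorem approx_orth_iff_chmielinski_orth:
  assumes "positive_op A" and "0 \<le> \<epsilon>"
  shows "approx_orth \<epsilon> A x y \<longleftrightarrow> chmielinski_orth \<epsilon> A x y"
proof -
  have "0 \<le> \<epsilon> * seminorm_op A x * seminorm_op A y"
    using assms by (simp add: seminorm_op_nonneg)
  \<comment> \<open>After expansion the squared seminorm of \<open>x\<close> cancels, and
    homogeneity turns the error term into \<open>2 * k * norm \<mu>\<close>.\<close>
  from norm_le_iff_inner_quadratic_nonneg[OF _ this,
      of "(seminorm_op A y)\<^sup>2" "inner_op A x y"]
  show ?thesis
    unfolding approx_orth_def chmielinski_orth_def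
      seminorm_op_add_scaleR_sq[OF assms(1)] seminorm_op_scaleR[OF assms(1)]
    by (simp add: algebra_simps)
qed

lemma cinner_add_right: "cinner z (x + y) = cinner z x + cinner z y"
  by (metis cinner_add_left cinner_commute complex_cnj_add)

lemma cinner_scaleC_right: "cinner x (c *\<^sub>C y) = cnj c * cinner x y"
  by (metis cinner_scaleC_left cinner_commute complex_cnj_mult)

lemma cpositive_op_Re_cinner_nonneg: "cpositive_op A \<Longrightarrow> 0 \<le> Re (cinner (A x) x)"
  unfolding cpositive_op_def complex_nonneg_Reals_iff by blast

lemma cseminorm_op_nonneg: "cpositive_op A \<Longrightarrow> 0 \<le> cseminorm_op A x"
  unfolding cseminorm_op_def by (intro real_sqrt_ge_zero cpositive_op_Re_cinner_nonneg)

lemma cseminorm_op_scaleC: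
  assumes "cpositive_op A"
  shows "cseminorm_op A (\<mu> *\<^sub>C x) = cmod \<mu> * cseminorm_op A x"
proof -
  have "cinner (A (\<mu> *\<^sub>C x)) (\<mu> *\<^sub>C x) = (\<mu> * cnj \<mu>) * cinner (A x) x"
    using assms by (simp add: cpositive_op_def cinner_scaleC_left cinner_scaleC_right)
  \<comment> \<open>Since \<open>\<mu> * cnj \<mu>\<close> is real, it can be pulled out of
    \<open>Re\<close>.\<close>
  then have "Re (cinner (A (\<mu> *\<^sub>C x)) (\<mu> *\<^sub>C x)) = (cmod \<mu>)\<^sup>2 * Re (cinner (A x) x)"
    by (simp flip: complex_norm_square of_real_power)
  then show ?thesis
    by (simp add: cseminorm_op_def real_sqrt_mult)
qed

text \<open>By symmetry of \<open>A\<close> the two cross terms are conjugate, so they add up to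
  twice the real part of \<open>cnj \<mu> * cinner_op A x y\<close>. That real part is the inner
  product of the complex plane viewed as a real space.\<close>

lemma cseminorm_op_add_scaleC_sq:
  assumes "cpositive_op A"
  shows "(cseminorm_op A (x + \<mu> *\<^sub>C y))\<^sup>2 =
    (cseminorm_op A x)\<^sup>2 + 2 * inner \<mu> (cinner_op A x y) + (norm \<mu>)\<^sup>2 * (cseminorm_op A y)\<^sup>2"
proof -
  interpret bounded_linear A using assms by (simp add: cpositive_op_def)
  have sq: "(cseminorm_op A z)\<^sup>2 = Re (cinner (A z) z)" for z
    unfolding cseminorm_op_def by (intro real_sqrt_pow2 cpositive_op_Re_cinner_nonneg assms)
  have hom: "A (\<mu> *\<^sub>C y) = \<mu> *\<^sub>C A y"
    using assms by (simp add: cpositive_op_def)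
  have "cinner (A y) x = cnj (cinner (A x) y)"
    using assms by (metis cpositive_op_def cinner_commute)
  then have "Re (cinner (A (x + \<mu> *\<^sub>C y)) (x + \<mu> *\<^sub>C y)) =
      Re (cinner (A x) x) + 2 * inner \<mu> (cinner (A x) y) + Re (cinner (A (\<mu> *\<^sub>C y)) (\<mu> *\<^sub>C y))"
    by (simp add: add hom cinner_add_left cinner_add_right cinner_scaleC_left cinner_scaleC_right
        inner_complex_def algebra_simps)
  then show ?thesis
    by (simp add: cinner_op_def cseminorm_op_scaleC[OF assms] power_mult_distrib flip: sq)
qed

theorem capprox_orth_iff_cchmielinski_orth:
  assumes "cpositive_op A" and "0 \<le> \<epsilon>"
  shows "capprox_orth \<epsilon> A x y \<longleftrightarrow> cchmielinski_orth \<epsilon> A x y"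
proof -
  have "0 \<le> \<epsilon> * cseminorm_op A x * cseminorm_op A y"
    using assms by (simp add: cseminorm_op_nonneg)
  from norm_le_iff_inner_quadratic_nonneg[OF _ this,
      of "(cseminorm_op A y)\<^sup>2" "cinner_op A x y"]
  show ?thesis
    unfolding capprox_orth_def cchmielinski_orth_def
      cseminorm_op_add_scaleC_sq[OF assms(1)] cseminorm_op_scaleC[OF assms(1)]
    by (simp add: algebra_simps)
qed

text \<open>The two choices of scalar field live in different type classes, hence one conjunct for
  each, over independent spaces.\<close>

theorem theorem2p7:
  fixes A :: "'a::{real_inner, complete_space} \<Rightarrow> 'a" and x y :: 'a
    and B :: "'b::{complex_inner, complete_space} \<Rightarrow> 'b" and u v :: 'b
    and \<epsilon> :: real
  assumes "0 \<le> \<epsilon>" and "\<epsilon> < 1"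
  shows "(positive_op A \<longrightarrow> (approx_orth \<epsilon> A x y \<longleftrightarrow> chmielinski_orth \<epsilon> A x y))
       \<and> (cpositive_op B \<longrightarrow> (capprox_orth \<epsilon> B u v \<longleftrightarrow> cchmielinski_orth \<epsilon> B u v))"
  using assms(1) approx_orth_iff_chmielinski_orth capprox_orth_iff_cchmielinski_orth by blast

end
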